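(* For every integer $n\ge 0$, $D_3(n)=3^{\mathrm{wt}(n)}$, where $\mathrm{wt}(n)$ is the number of ones in the binary expansion of $n$.
   Context: A P-position of the game of Nim with $k$ piles is a $k$-tuple $(p_1,\dots,p_k)$ of non-negative integers whose nim-sum $p_1\oplus\cdots\oplus p_k$ is $0$, where $\oplus$ denotes bitwise XOR. $D_k(n)$ denotes the number of P-positions with $k$ piles whose total number of counters $p_1+\cdots+p_k$ equals exactly $2n$. *)

theory Defs
  imports Main
begin

definition nim_sum :: "nat list \<Rightarrow> nat" where
  "nim_sum ps = foldr Bit_Operations.xor ps 0"

definition P_positions :: "nat \<Rightarrow> nat list set" where
  "P_positions k = {ps. length ps = k \<and> nim_sum ps = 0}"

definition D :: "nat \<Rightarrow> nat \<Rightarrow> nat" where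
  "D k n = card {ps \<in> P_positions k. sum_list ps = 2 * n}"

(* card of an infinite set is 0, so finiteness is what makes this a genuine count. *)
lemma finite_D: "finite {ps \<in> P_positions k. sum_list ps = 2 * n}"
proof (rule finite_subset)
  show "{ps \<in> P_positions k. sum_list ps = 2 * n} \<subseteq> {ps. set ps \<subseteq> {..2 * n} \<and> length ps = k}"
    by (auto simp: P_positions_def dest: member_le_sum_list)
  show "finite {ps. set ps \<subseteq> {..2 * n} \<and> length ps = k}"
    by (rule finite_lists_length_eq) simp
qed

definition wt :: "nat \<Rightarrow> nat" where
  "wt n = card {i. bit n i}"

(* Likewise for the number of ones in the binary expansion. *)
lemma finite_bits: "finite {i. bit (n::nat) i}"
proof (rule finite_subset)
  show "{i. bit n i} \<subseteq> {..n}"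
  proof
    fix i assume "i \<in> {i. bit n i}"
    then have "n div 2 ^ i \<noteq> 0" by (auto simp: bit_iff_odd elim: oddE)
    then have "2 ^ i \<le> n" by (simp add: div_eq_0_iff)
    with less_exp[of i] have "i < n" by (rule less_le_trans)
    then show "i \<in> {..n}" by simp
  qed
qed simp

end

theory Submission
  imports Defs
begin

unbundle bit_operations_syntax

text \<open>
  A P-position with three piles has the form \<open>(a, b, a XOR b)\<close>, and
  \<open>a + b + (a XOR b) = 2 * (a OR b)\<close>. So \<open>D 3 n\<close> counts the pairs with
  \<open>a OR b = n\<close>: each one bit of \<open>n\<close> leaves three choices for the
  corresponding bits of \<open>a\<close> and \<open>b\<close>, each zero bit only one.
\<close>

text \<open>In each binary column, the bits of \<open>a\<close>, \<open>b\<close> and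
  \<open>a XOR b\<close> are either all 0 or contain exactly two ones. Halving both numbers strips
  the lowest column, hence the induction with \<open>b\<close> arbitrary.\<close>

lemma add_xor_eq_double_or: "a + b + (a XOR b) = 2 * (a OR b)" for a b :: nat
proof (induction a arbitrary: b rule: less_induct)
  case (less a)
  show ?case
  proof (cases "a = 0")
    case False
    then have IH: "a div 2 + b div 2 + (a div 2 XOR b div 2) = 2 * (a div 2 OR b div 2)"
      by (intro less) simp
    then show ?thesis
      unfolding or_rec[of a b] xor_rec[of a b]
      by (cases "even a"; cases "even b") (auto elim!: evenE oddE)
  qed simp
qed

text \<open>Appending the binary digit \<open>e\<close> shifts the one bits of \<open>n\<close> up
  by one place and adds position 0 exactly if \<open>e = 1\<close>.\<close>

lemma wt_double_add: "wt (2 * n + e) = wt n + e" if "e < 2"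
proof -
  have "{i. bit (2 * n + e) i} = {i. i = 0 \<and> e = 1} \<union> Suc ` {i. bit n i}"
  proof (rule set_eqI)
    fix i show "i \<in> {i. bit (2 * n + e) i} \<longleftrightarrow> i \<in> {i. i = 0 \<and> e = 1} \<union> Suc ` {i. bit n i}"
      using that by (cases i) (auto simp: bit_0 bit_Suc less_2_cases_iff)
  qed
  then show ?thesis
    using that by (auto simp: wt_def card_image finite_bits less_2_cases_iff)
qed

definition or_pairs :: "nat \<Rightarrow> (nat \<times> nat) set" where
  "or_pairs n = {(a, b). a OR b = n}"

lemma or_double_add:
  "(2 * a + i) OR (2 * b + j) = 2 * (a OR b) + (i OR j)" if "i < 2" "j < 2" for a b i j :: nat
  using that by (auto simp: less_2_cases_iff or_rec[of "2 * a + i" for i] or_rec[of "Suc (2 * a)"])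

text \<open>Splitting off the lowest bits of \<open>a\<close> and \<open>b\<close> leaves a pair in
  \<open>or_pairs n\<close>; the split-off bits form an independent pair with OR equal to
  \<open>e\<close>, for which there are \<open>3 ^ e\<close> choices.\<close>

lemma card_or_pairs_double_add: "card (or_pairs (2 * n + e)) = 3 ^ e * card (or_pairs n)" if "e < 2"
proof -
  define T where "T = {(i, j) \<in> {..<2} \<times> {..<2}. i OR j = e}"
  define f :: "(nat \<times> nat) \<times> nat \<times> nat \<Rightarrow> nat \<times> nat"
    where "f = (\<lambda>((i, j), (a, b)). (2 * a + i, 2 * b + j))"
  have T: "T \<subseteq> {..<2} \<times> {..<2}"
    by (auto simp: T_def)
  have "T = (if e = 0 then {(0, 0)} else {(0, 1), (1, 0), (1, 1)})"
    using that by (auto simp: T_def less_2_cases_iff)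
  then have card_T: "card T = 3 ^ e"
    using that by (auto simp: less_2_cases_iff)
  have f_inj: "inj_on f (T \<times> or_pairs n)"
  proof (rule inj_on_inverseI)
    fix x assume "x \<in> T \<times> or_pairs n"
    then show "(\<lambda>(a, b). ((a mod 2, b mod 2), (a div 2, b div 2))) (f x) = x"
      using T by (auto simp: f_def)
  qed
  have "or_pairs (2 * n + e) = f ` (T \<times> or_pairs n)"
  proof (intro set_eqI iffI)
    fix x assume x: "x \<in> or_pairs (2 * n + e)"
    obtain a b where [simp]: "x = (a, b)" by fastforce
    have "(2 * (a div 2) + a mod 2) OR (2 * (b div 2) + b mod 2) = 2 * n + e"
      using x by (simp add: or_pairs_def)
    then have eq: "2 * (a div 2 OR b div 2) + (a mod 2 OR b mod 2) = 2 * n + e"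
      by (subst (asm) or_double_add) simp_all
    \<comment> \<open>Since \<open>e\<close> is also below 2, both sides of \<open>eq\<close> are
      divisions by 2 with remainder, so quotients and remainders agree.\<close>
    have "a mod 2 OR b mod 2 < 2"
      by (cases "even a"; cases "even b") (simp_all add: mod2_eq_if)
    with eq that have "a div 2 OR b div 2 = n"
      by linarith
    with eq have "((a mod 2, b mod 2), (a div 2, b div 2)) \<in> T \<times> or_pairs n"
      by (simp add: T_def or_pairs_def)
    then show "x \<in> f ` (T \<times> or_pairs n)"
      by (rule rev_image_eqI) (simp add: f_def)
  next
    fix x assume "x \<in> f ` (T \<times> or_pairs n)"
    then show "x \<in> or_pairs (2 * n + e)"
      by (auto simp: f_def T_def or_pairs_def or_double_add)
  qed
  with f_inj show ?thesis
    by (simp add: card_image card_cartesian_product card_T)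
qed

lemma or_pairs_0: "or_pairs 0 = {(0, 0)}"
  by (auto simp: or_pairs_def or_eq_0_iff)

lemma card_or_pairs: "card (or_pairs n) = 3 ^ wt n"
proof (induction n rule: nat_bit_induct)
  case zero
  show ?case by (simp add: or_pairs_0 wt_def)
next
  case (even n)
  then show ?case
    using card_or_pairs_double_add[of 0 n] wt_double_add[of 0 n] by simp
next
  case (odd n)
  then show ?case
    using card_or_pairs_double_add[of 1 n] wt_double_add[of 1 n] by simp
qed

text \<open>Under XOR every number is its own inverse, so two piles determine the third.\<close>

lemma nim_sum_3_eq_0_iff: "nim_sum [a, b, c] = 0 \<longleftrightarrow> c = a XOR b"
proof -
  have "a XOR (b XOR c) = 0 \<longleftrightarrow> c = a XOR b"
    by (metis xor.assoc xor.left_neutral xor.right_neutral xor_self_eq)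
  then show ?thesis
    by (simp add: nim_sum_def)
qed

theorem theorem19:
  fixes n :: nat
  shows "D 3 n = 3 ^ wt n"
proof -
  let ?f = "\<lambda>(a, b). [a, b, a XOR b]"
  have "{ps \<in> P_positions 3. sum_list ps = 2 * n} = ?f ` or_pairs n"
  proof (intro set_eqI iffI)
    fix ps assume ps: "ps \<in> {ps \<in> P_positions 3. sum_list ps = 2 * n}"
    then obtain a b c where abc: "ps = [a, b, c]"
      by (auto simp: P_positions_def numeral_3_eq_3 length_Suc_conv)
    with ps have "c = a XOR b"
      by (simp add: P_positions_def nim_sum_3_eq_0_iff)
    \<comment> \<open>The total is \<open>2 * (a OR b)\<close>, so its being \<open>2 * n\<close>
      forces \<open>a OR b = n\<close>.\<close>
    with abc ps show "ps \<in> ?f ` or_pairs n"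
      using add_xor_eq_double_or[of a b] by (auto simp: or_pairs_def)
  next
    fix ps assume "ps \<in> ?f ` or_pairs n"
    then obtain a b where "ps = [a, b, a XOR b]" "a OR b = n"
      by (auto simp: or_pairs_def)
    then show "ps \<in> {ps \<in> P_positions 3. sum_list ps = 2 * n}"
      using add_xor_eq_double_or[of a b] by (simp add: P_positions_def nim_sum_3_eq_0_iff)
  qed
  moreover have "inj_on ?f (or_pairs n)"
    by (auto simp: inj_on_def)
  ultimately show ?thesis
    by (simp add: D_def card_image card_or_pairs)
qed

end
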